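(* Let $G$ be a finite simple graph, not necessarily connected, such that $d_G(v)$ is odd and $d_G(v)\ge 3$ for every $v\in V(G)$. Then the $2$-subdivision $S_2(G)$ is strongly antimagic.
   Context: All graphs are finite and simple and are not required to be connected. For a graph $H$, $d_H(v)$ denotes the degree of a vertex $v$ in $H$, and for a positive integer $r$, $[r]=\{1,2,\ldots,r\}$. $2$-subdivision: $S_2(G)$ is the graph obtained from $G$ by subdividing every edge exactly twice, i.e. every edge $uv$ of $G$ is replaced by a path $u\,x\,y\,v$ of length three, where $x,y$ are two new vertices (distinct new vertices being used for distinct edges). Thus $S_2(G)$ has $3|E(G)|$ edges. Antimagic labeling: for a graph $H$ with $M$ edges, an antimagic labeling of $H$ is a bijection $f:E(H)\to[M]$ such that the vertex sums $\sigma_f(v)=\sum_{e\ni v}f(e)$ (the sum over the edges $e$ of $H$ incident with $v$), for $v\in V(H)$, are pairwise distinct. An antimagic labeling $f$ is strongly antimagic if, for all $u,v\in V(H)$, $d_H(u)<d_H(v)$ implies $\sigma_f(u)<\sigma_f(v)$. A graph is strongly antimagic if it admits a strongly antimagic labeling. *)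

theory Defs
  imports Main
begin

record 'a ugraph =
  verts :: "'a set"
  edges :: "'a set set"

definition simple_graph :: "'a ugraph \<Rightarrow> bool" where
  "simple_graph G \<longleftrightarrow> finite (verts G) \<and>
     (\<forall>e\<in>edges G. \<exists>u\<in>verts G. \<exists>v\<in>verts G. u \<noteq> v \<and> e = {u, v})"

definition incident_edges :: "'a ugraph \<Rightarrow> 'a \<Rightarrow> 'a set set" where
  "incident_edges G v = {e \<in> edges G. v \<in> e}"

definition degree :: "'a ugraph \<Rightarrow> 'a \<Rightarrow> nat" where
  "degree G v = card (incident_edges G v)"

text \<open>An edge \<open>{u, v}\<close> is replaced by the path \<open>Orig u, Sub u v, Sub v u, Orig v\<close>:
  \<open>Sub u v\<close> is the new vertex on that edge adjacent to the end \<open>u\<close>. Since \<open>{u, v} = {v, u}\<close>,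
  the comprehensions below contribute both new vertices and both outer edges of the path,
  and the middle edge once.\<close>

datatype 'a subdiv_vertex = Orig 'a | Sub 'a 'a

definition subdivision2 :: "'a ugraph \<Rightarrow> 'a subdiv_vertex ugraph" where
  "subdivision2 G =
     \<lparr>verts = Orig ` verts G \<union> {Sub u v | u v. {u, v} \<in> edges G},
      edges = {{Orig u, Sub u v} | u v. {u, v} \<in> edges G} \<union>
              {{Sub u v, Sub v u} | u v. {u, v} \<in> edges G}\<rparr>"

definition vertex_sum :: "'a ugraph \<Rightarrow> ('a set \<Rightarrow> nat) \<Rightarrow> 'a \<Rightarrow> nat" where
  "vertex_sum G f v = (\<Sum>e\<in>incident_edges G v. f e)"

definition antimagic_labeling :: "'a ugraph \<Rightarrow> ('a set \<Rightarrow> nat) \<Rightarrow> bool" where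
  "antimagic_labeling G f \<longleftrightarrow>
     bij_betw f (edges G) {1..card (edges G)} \<and> inj_on (vertex_sum G f) (verts G)"

definition strongly_antimagic_labeling :: "'a ugraph \<Rightarrow> ('a set \<Rightarrow> nat) \<Rightarrow> bool" where
  "strongly_antimagic_labeling G f \<longleftrightarrow> antimagic_labeling G f \<and>
     (\<forall>u\<in>verts G. \<forall>v\<in>verts G. degree G u < degree G v \<longrightarrow> vertex_sum G f u < vertex_sum G f v)"

definition strongly_antimagic :: "'a ugraph \<Rightarrow> bool" where
  "strongly_antimagic G \<longleftrightarrow> (\<exists>f. strongly_antimagic_labeling G f)"

lemma simple_graph_edges_finite: "simple_graph G \<Longrightarrow> finite (edges G)"
  by (rule finite_subset[of _ "Pow (verts G)"]) (auto simp: simple_graph_def)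

lemma simple_graph_edgeD:
  "simple_graph G \<Longrightarrow> {u, v} \<in> edges G \<Longrightarrow> u \<in> verts G \<and> v \<in> verts G \<and> u \<noteq> v"
  unfolding simple_graph_def by (metis doubleton_eq_iff)

lemma simple_graph_subdivision2:
  assumes "simple_graph G"
  shows "simple_graph (subdivision2 G)"
proof -
  have sub: "{Sub u v | u v. {u, v} \<in> edges G} \<subseteq> (\<lambda>(u, v). Sub u v) ` (verts G \<times> verts G)"
    using simple_graph_edgeD[OF assms] by auto
  have fin: "finite (verts G)"
    using assms by (simp add: simple_graph_def)
  have "finite {Sub u v | u v. {u, v} \<in> edges G}"
    using fin by (intro finite_subset[OF sub]) simp
  with fin have "finite (verts (subdivision2 G))"
    by (simp add: subdivision2_def)
  moreover have "\<exists>x\<in>verts (subdivision2 G). \<exists>y\<in>verts (subdivision2 G). x \<noteq> y \<and> e = {x, y}"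
    if "e \<in> edges (subdivision2 G)" for e
  proof -
    from that obtain u v where uv: "{u, v} \<in> edges G"
      and e: "e = {Orig u, Sub u v} \<or> e = {Sub u v, Sub v u}"
      by (auto simp: subdivision2_def)
    have "{v, u} \<in> edges G" using uv by (simp add: insert_commute)
    then have in_verts: "Orig u \<in> verts (subdivision2 G)" "Sub u v \<in> verts (subdivision2 G)"
      "Sub v u \<in> verts (subdivision2 G)"
      using uv simple_graph_edgeD[OF assms uv] by (auto simp: subdivision2_def)
    have "Sub u v \<noteq> Sub v u"
      using simple_graph_edgeD[OF assms uv] by simp
    show ?thesis
      using e
    proof
      assume "e = {Orig u, Sub u v}"
      then have "Orig u \<noteq> Sub u v \<and> e = {Orig u, Sub u v}" by simp
      then show ?thesis using in_verts(1,2) by (intro bexI)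
    next
      assume "e = {Sub u v, Sub v u}"
      with \<open>Sub u v \<noteq> Sub v u\<close> have "Sub u v \<noteq> Sub v u \<and> e = {Sub u v, Sub v u}" by simp
      then show ?thesis using in_verts(2,3) by (intro bexI)
    qed
  qed
  ultimately show ?thesis by (simp add: simple_graph_def)
qed

lemma card_edges_subdivision2:
  assumes "simple_graph G"
  shows "card (edges (subdivision2 G)) = 3 * card (edges G)"
proof -
  define P where "P e = {s. \<exists>u v. {u, v} = e \<and>
    (s = {Orig u, Sub u v} \<or> s = {Sub u v, Sub v u})}" for e :: "'a set"
  have P: "P {u, v} = {{Orig u, Sub u v}, {Orig v, Sub v u}, {Sub u v, Sub v u}}" for u v
    unfolding P_def by (auto simp: doubleton_eq_iff)
  have "edges (subdivision2 G) = {s. \<exists>u v. {u, v} \<in> edges G \<and>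
      (s = {Orig u, Sub u v} \<or> s = {Sub u v, Sub v u})}"
    by (simp add: subdivision2_def Collect_disj_eq[symmetric] conj_disj_distribL ex_disj_distrib conj_commute)
  also have "\<dots> = (\<Union>e\<in>edges G. P e)"
  proof -
    have "(\<exists>u v. {u, v} \<in> edges G \<and> Q u v) \<longleftrightarrow> (\<exists>e\<in>edges G. \<exists>u v. {u, v} = e \<and> Q u v)"
      for Q :: "'a \<Rightarrow> 'a \<Rightarrow> bool"
      by metis
    then show ?thesis
      unfolding P_def by (intro set_eqI) (simp only: UN_iff mem_Collect_eq)
  qed
  also have "card \<dots> = (\<Sum>e\<in>edges G. card (P e))"
  proof (rule card_UN_disjoint)
    show "finite (edges G)" by (rule simple_graph_edges_finite[OF assms])
    have ex: "\<exists>u v. u \<noteq> v \<and> e = {u, v}" if "e \<in> edges G" for e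
      using assms that unfolding simple_graph_def by blast
    show "\<forall>e\<in>edges G. finite (P e)" using ex by (fastforce simp: P)
    have ends: "e = {w. \<exists>x. Sub w x \<in> s \<or> Sub x w \<in> s}" if "s \<in> P e" for s e
      using that unfolding P_def by auto
    show "\<forall>d\<in>edges G. \<forall>e\<in>edges G. d \<noteq> e \<longrightarrow> P d \<inter> P e = {}"
      using ends by blast
  qed
  also have "\<dots> = (\<Sum>e\<in>edges G. 3)"
  proof (rule sum.cong)
    fix e assume "e \<in> edges G"
    then obtain u v where "u \<noteq> v" "e = {u, v}"
      using assms unfolding simple_graph_def by blast
    then show "card (P e) = 3" by (simp add: P doubleton_eq_iff)
  qed simp
  finally show ?thesis by simp
qed

end

theory Submission
  imports Defs "HOL-Library.Multiset"
begin

text \<open>Let \<open>m\<close> be the number of edges of \<open>G\<close>. Decompose \<open>G\<close> into as few trails as possible. Two trails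
  sharing an end vertex could be joined, so by parity every vertex is an end of exactly one trail,
  exactly once. Concatenate the trails. The outer edges of the subdivision receive the labels
  \<open>m + 1, \<dots>, 3 * m\<close> such that the head of each edge and the tail of the next one sum to \<open>4 * m\<close>;
  hence a vertex of degree \<open>2 * k + 1\<close> has sum \<open>4 * m * k + x\<close>, where \<open>x\<close> is the label of its only
  unpaired outer edge. These sums are distinct, increase with the degree and exceed \<open>4 * m\<close>, an
  upper bound for the sums of the new vertices once the middle edges have the labels \<open>1, \<dots>, m\<close>.
  It remains to arrange the labels along the concatenation so that the sums of the new vertices
  are distinct.\<close>

text \<open>A pair \<open>(u, v)\<close> stands for the edge \<open>{u, v}\<close> traversed from its tail \<open>u\<close> to its head \<open>v\<close>.\<close>

definition dart_edge :: "'a \<times> 'a \<Rightarrow> 'a set" where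
  "dart_edge d = {fst d, snd d}"

text \<open>Equality of multisets makes every edge occur exactly once, in one of its two
  orientations, and turns reversing or joining trails into additive equations.\<close>

definition edge_order :: "'a ugraph \<Rightarrow> ('a \<times> 'a) list \<Rightarrow> bool" where
  "edge_order G ds \<longleftrightarrow> mset (map dart_edge ds) = mset_set (edges G)"

abbreviation trail :: "('a \<times> 'a) list \<Rightarrow> bool" where
  "trail \<equiv> successively (\<lambda>d e. snd d = fst e)"

definition trail_decomposition :: "'a ugraph \<Rightarrow> ('a \<times> 'a) list list \<Rightarrow> bool" where
  "trail_decomposition G xss \<longleftrightarrow>
     edge_order G (concat xss) \<and> (\<forall>T\<in>set xss. T \<noteq> [] \<and> trail T)"

text \<open>A closed trail counts twice at its base vertex.\<close>

definition trail_ends :: "'a \<Rightarrow> ('a \<times> 'a) list \<Rightarrow> nat" where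
  "trail_ends v T = of_bool (fst (hd T) = v) + of_bool (snd (last T) = v)"

definition reverse_trail :: "('a \<times> 'a) list \<Rightarrow> ('a \<times> 'a) list" where
  "reverse_trail T = rev (map prod.swap T)"

text \<open>For an edge order, constant 1 for \<open>A\<close> and \<open>B\<close> gives the degree
  of \<open>v\<close>, and the labels of the outer edges give the vertex sum at
  \<open>Orig v\<close>.\<close>

definition dart_sum :: "'a \<Rightarrow> (nat \<Rightarrow> nat) \<Rightarrow> (nat \<Rightarrow> nat) \<Rightarrow> ('a \<times> 'a) list \<Rightarrow> nat" where
  "dart_sum v A B ds =
     (\<Sum>i<length ds. of_bool (fst (ds ! i) = v) * A i + of_bool (snd (ds ! i) = v) * B i)"

text \<open>These sets remember at which vertex an unpaired label sits, which later separates
  vertices of equal degree.\<close>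

definition dart_values :: "'a \<Rightarrow> (nat \<Rightarrow> nat) \<Rightarrow> (nat \<Rightarrow> nat) \<Rightarrow> ('a \<times> 'a) list \<Rightarrow> nat set" where
  "dart_values v A B ds =
     {A i | i. i < length ds \<and> fst (ds ! i) = v} \<union> {B i | i. i < length ds \<and> snd (ds ! i) = v}"

subsection \<open>Trail decompositions\<close>

lemma trail_ends_le: "trail_ends v T \<le> 2"
  by (simp add: trail_ends_def)

lemma reverse_trail_simps:
  assumes "T \<noteq> []"
  shows "reverse_trail T \<noteq> []" "fst (hd (reverse_trail T)) = snd (last T)"
    "snd (last (reverse_trail T)) = fst (hd T)"
    "trail (reverse_trail T) \<longleftrightarrow> trail T"
  using assms by (auto simp: reverse_trail_def hd_rev last_rev last_map hd_map successively_map
      prod.swap_def eq_commute)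

lemma mset_reverse_trail: "mset (map dart_edge (reverse_trail T)) = mset (map dart_edge T)"
proof -
  have "dart_edge \<circ> prod.swap = (dart_edge :: 'a \<times> 'a \<Rightarrow> 'a set)"
    by (auto simp: dart_edge_def fun_eq_iff)
  then show ?thesis by (simp add: reverse_trail_def rev_map[symmetric])
qed

lemma trail_ending_at:
  assumes "T \<noteq> []" "trail T" "trail_ends v T \<noteq> 0"
  obtains T' where "T' \<noteq> []" "trail T'" "snd (last T') = v"
    "mset (map dart_edge T') = mset (map dart_edge T)"
  using assms reverse_trail_simps[of T] mset_reverse_trail[of T] that[of T] that[of "reverse_trail T"]
  by (auto simp: trail_ends_def split: if_splits)

text \<open>Both trails are turned so that they end at \<open>v\<close>; then the first continues
  along the reversal of the second.\<close>

lemma join_trails: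
  assumes S: "S \<noteq> []" "trail S" "trail_ends v S \<noteq> 0"
    and T: "T \<noteq> []" "trail T" "trail_ends v T \<noteq> 0"
  obtains U where "U \<noteq> []" "trail U"
    "mset (map dart_edge U) = mset (map dart_edge S) + mset (map dart_edge T)"
proof -
  obtain S' where S': "S' \<noteq> []" "trail S'" "snd (last S') = v"
    "mset (map dart_edge S') = mset (map dart_edge S)"
    using trail_ending_at[OF S] .
  obtain T' where T': "T' \<noteq> []" "trail T'" "snd (last T') = v"
    "mset (map dart_edge T') = mset (map dart_edge T)"
    using trail_ending_at[OF T] .
  show thesis
  proof (rule that[of "S' @ reverse_trail T'"])
    show "trail (S' @ reverse_trail T')"
      using S' T' by (simp add: successively_append_iff reverse_trail_simps)
    show "mset (map dart_edge (S' @ reverse_trail T')) =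
        mset (map dart_edge S) + mset (map dart_edge T)"
      using S' T' mset_reverse_trail[of T'] by simp
  qed (use S' in simp)
qed

text \<open>One entry contributes at most 2, so a total of 3 needs entries at two positions. For
  \<open>trail_ends v\<close> this yields two trails with an end at \<open>v\<close>, rather than
  one closed trail.\<close>

lemma split_two_positive:
  fixes f :: "'b \<Rightarrow> nat"
  assumes "\<And>x. f x \<le> 2" "sum_list (map f xs) \<ge> 3"
  shows "\<exists>P x Q y R. xs = P @ x # Q @ y # R \<and> f x \<noteq> 0 \<and> f y \<noteq> 0"
  using assms(2)
proof (induction xs)
  case (Cons x xs)
  show ?case
  proof (cases "f x = 0")
    case True
    with Cons obtain P x' Q y R where "xs = P @ x' # Q @ y # R" "f x' \<noteq> 0" "f y \<noteq> 0"
      by auto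
    then show ?thesis by (metis append_Cons)
  next
    case False
    have "sum_list (map f xs) \<noteq> 0"
      using assms(1)[of x] Cons.prems by (simp del: sum_list_eq_0_iff)
    then obtain y where "y \<in> set xs" "f y \<noteq> 0"
      by (auto simp: sum_list_eq_0_iff)
    then obtain Q R where "xs = Q @ y # R" by (meson split_list)
    with False \<open>f y \<noteq> 0\<close> show ?thesis by (metis append_Nil)
  qed
qed simp

text \<open>Every edge forms a trail of its own. This makes a decomposition of minimal length
  available.\<close>

lemma trail_decomposition_exists:
  assumes "simple_graph G"
  shows "\<exists>xss. trail_decomposition G xss"
proof -
  obtain es where es: "set es = edges G" "distinct es"
    using finite_distinct_list[OF simple_graph_edges_finite[OF assms]] by blast
  have "\<forall>e\<in>edges G. \<exists>d. dart_edge d = e"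
    using assms unfolding simple_graph_def dart_edge_def by fastforce
  then obtain d where d: "\<And>e. e \<in> edges G \<Longrightarrow> dart_edge (d e) = e" by metis
  have "concat (map (\<lambda>e. [d e]) es) = map d es" by (induction es) auto
  moreover have "map dart_edge (map d es) = es"
    unfolding map_map using d es(1) by (intro map_idI) simp
  ultimately have "edge_order G (concat (map (\<lambda>e. [d e]) es))"
    using es by (simp add: edge_order_def mset_set_set flip: es(1))
  then have "trail_decomposition G (map (\<lambda>e. [d e]) es)"
    by (auto simp: trail_decomposition_def)
  then show ?thesis ..
qed

subsection \<open>Sums along trails\<close>

lemma dart_sum_append:
  "dart_sum v A B (xs @ ys) = dart_sum v A B xs +
     dart_sum v (\<lambda>i. A (length xs + i)) (\<lambda>i. B (length xs + i)) ys"
proof -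
  have "(\<Sum>i<a + b. g i) = (\<Sum>i<a. g i) + (\<Sum>i<b. g (a + i))" for a b and g :: "nat \<Rightarrow> nat"
    by (induction b) (auto simp: add.assoc)
  then show ?thesis by (simp add: dart_sum_def nth_append)
qed

lemma dart_sum_Cons:
  "dart_sum v A B (d # ds) = of_bool (fst d = v) * A 0 + of_bool (snd d = v) * B 0 +
     dart_sum v (\<lambda>i. A (Suc i)) (\<lambda>i. B (Suc i)) ds"
  using dart_sum_append[of v A B "[d]" ds] by (simp add: dart_sum_def)

lemma dart_values_append:
  "dart_values v A B (xs @ ys) = dart_values v A B xs \<union>
     dart_values v (\<lambda>i. A (length xs + i)) (\<lambda>i. B (length xs + i)) ys"
proof -
  have *: "{f i | i. i < a + b \<and> P i} = {f i | i. i < a \<and> P i} \<union> {f (a + i) | i. i < b \<and> P (a + i)}"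
    for f :: "nat \<Rightarrow> nat" and a b P
  proof -
    have "i < a + b \<longleftrightarrow> i < a \<or> (\<exists>j<b. i = a + j)" for i
      by (metis add_less_cancel_left le_Suc_ex linorder_not_less trans_less_add1)
    then show ?thesis by blast
  qed
  show ?thesis
    unfolding dart_values_def length_append *
    by (auto simp: nth_append)
qed

text \<open>Every passage through \<open>v\<close> pairs a head with the next tail and contributes
  \<open>C\<close> to the sum and 2 to the degree, so the same \<open>k\<close> counts passages in
  both equations. Only the two ends stay unpaired.\<close>

lemma trail_sum:
  assumes "T \<noteq> []" "trail T" "\<And>i. Suc i < length T \<Longrightarrow> A (Suc i) + B i = C"
  shows "\<exists>k. dart_sum v A B T = C * k + of_bool (fst (hd T) = v) * A 0
            + of_bool (snd (last T) = v) * B (length T - 1) \<and>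
          dart_sum v (\<lambda>_. 1) (\<lambda>_. 1) T = 2 * k + trail_ends v T"
  using assms
proof (induction T arbitrary: A B)
  case (Cons d T)
  show ?case
  proof (cases "T = []")
    case True
    then show ?thesis by (simp add: dart_sum_def trail_ends_def)
  next
    case False
    then obtain k where k: "dart_sum v (\<lambda>i. A (Suc i)) (\<lambda>i. B (Suc i)) T = C * k
        + of_bool (fst (hd T) = v) * A 1 + of_bool (snd (last T) = v) * B (Suc (length T - 1))"
      "dart_sum v (\<lambda>_. 1) (\<lambda>_. 1) T = 2 * k + trail_ends v T"
      using Cons.IH[of "\<lambda>i. A (Suc i)" "\<lambda>i. B (Suc i)"] Cons.prems
      by (auto simp: successively_Cons)
    have "snd d = fst (hd T)" "A 1 + B 0 = C"
      using Cons.prems False by (auto simp: successively_Cons)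
    then show ?thesis
      using k False
      \<comment> \<open>The junction of \<open>d\<close> and \<open>T\<close> is a further passage
        exactly when it lies at \<open>v\<close>.\<close>
      by (intro exI[of _ "k + of_bool (snd d = v)"])
        (auto simp: dart_sum_Cons trail_ends_def algebra_simps)
  qed
qed simp

text \<open>The passages of all trails add up, and \<open>L\<close> collects with multiplicity the
  labels left over at the trail ends at \<open>v\<close>.\<close>

lemma concat_trails_sum:
  assumes "\<forall>T\<in>set xss. T \<noteq> [] \<and> trail T"
    and "\<And>i. Suc i < length (concat xss) \<Longrightarrow> A (Suc i) + B i = C"
  shows "\<exists>k L. dart_sum v A B (concat xss) = C * k + sum_list L \<and>
          dart_sum v (\<lambda>_. 1) (\<lambda>_. 1) (concat xss) = 2 * k + length L \<and>
          length L = sum_list (map (trail_ends v) xss) \<and>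
          set L \<subseteq> dart_values v A B (concat xss)"
  using assms
proof (induction xss arbitrary: A B)
  case Nil
  show ?case by (intro exI[of _ 0] exI[of _ "[]"]) (simp add: dart_sum_def)
next
  case (Cons T xss)
  have T: "T \<noteq> []" "trail T" using Cons.prems(1) by auto
  obtain j where j: "dart_sum v A B T = C * j + of_bool (fst (hd T) = v) * A 0
            + of_bool (snd (last T) = v) * B (length T - 1)"
          "dart_sum v (\<lambda>_. 1) (\<lambda>_. 1) T = 2 * j + trail_ends v T"
    using trail_sum[OF T, of A B C v] Cons.prems(2) by auto
  define L0 where "L0 = (if fst (hd T) = v then [A 0] else [])
      @ (if snd (last T) = v then [B (length T - 1)] else [])"
  have L0: "dart_sum v A B T = C * j + sum_list L0" "length L0 = trail_ends v T"
    "set L0 \<subseteq> dart_values v A B T"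
    using j(1) T by (auto simp: L0_def trail_ends_def dart_values_def hd_conv_nth last_conv_nth)
  let ?A = "\<lambda>i. A (length T + i)" and ?B = "\<lambda>i. B (length T + i)"
  obtain k L where kL: "dart_sum v ?A ?B (concat xss) = C * k + sum_list L"
          "dart_sum v (\<lambda>_. 1) (\<lambda>_. 1) (concat xss) = 2 * k + length L"
          "length L = sum_list (map (trail_ends v) xss)"
          "set L \<subseteq> dart_values v ?A ?B (concat xss)"
    using Cons.IH[of ?A ?B] Cons.prems by fastforce
  show ?case
    using j(2) L0 kL
    by (intro exI[of _ "j + k"] exI[of _ "L0 @ L"])
      (auto simp: dart_sum_append dart_values_append algebra_simps)
qed

subsection \<open>Edge orders\<close>

lemma edge_orderD:
  assumes "simple_graph G" "edge_order G ds"
  shows "distinct (map dart_edge ds)" "dart_edge ` set ds = edges G" "length ds = card (edges G)"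
proof -
  have fin: "finite (edges G)" using assms(1) by (rule simple_graph_edges_finite)
  have eq: "mset (map dart_edge ds) = mset_set (edges G)"
    using assms(2) by (simp add: edge_order_def)
  show s: "dart_edge ` set ds = edges G"
    using arg_cong[OF eq, of set_mset] fin by simp
  show l: "length ds = card (edges G)"
    using arg_cong[OF eq, of size] by simp
  \<comment> \<open>As many entries as edges leave no room for a repetition.\<close>
  show "distinct (map dart_edge ds)"
    using s l by (intro card_distinct) simp
qed

lemma degree_dart_sum:
  assumes "simple_graph G" "edge_order G ds"
  shows "degree G v = dart_sum v (\<lambda>_. 1) (\<lambda>_. 1) ds"
proof -
  note ds = edge_orderD[OF assms]
  have inj: "inj_on (\<lambda>i. dart_edge (ds ! i)) {..<length ds}"
    using ds(1) by (auto simp: inj_on_def distinct_conv_nth)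
  have im: "(\<lambda>i. dart_edge (ds ! i)) ` {..<length ds} = edges G"
    using ds(2) by (auto simp: set_conv_nth)
  have "degree G v = (\<Sum>e\<in>edges G. of_bool (v \<in> e))"
    unfolding degree_def incident_edges_def
    using simple_graph_edges_finite[OF assms(1)] by (simp add: Int_def)
  also have "\<dots> = (\<Sum>i<length ds. of_bool (v \<in> dart_edge (ds ! i)))"
    unfolding im[symmetric] by (simp only: sum.reindex[OF inj] o_def)
  also have "\<dots> = dart_sum v (\<lambda>_. 1) (\<lambda>_. 1) ds"
    unfolding dart_sum_def
  proof (rule sum.cong)
    fix i assume "i \<in> {..<length ds}"
    then have "{fst (ds ! i), snd (ds ! i)} \<in> edges G"
      using im by (auto simp: dart_edge_def)
    \<comment> \<open>Without loops at most one of the two indicators is 1.\<close>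
    then have "fst (ds ! i) \<noteq> snd (ds ! i)"
      using simple_graph_edgeD[OF assms(1)] by blast
    then show "of_bool (v \<in> dart_edge (ds ! i)) =
        of_bool (fst (ds ! i) = v) * 1 + of_bool (snd (ds ! i) = v) * (1::nat)"
      by (auto simp: dart_edge_def)
  qed simp
  finally show ?thesis .
qed

lemma odd_trail_decomposition:
  assumes G: "simple_graph G" and odd: "\<forall>v\<in>verts G. odd (degree G v)"
  obtains xss where "trail_decomposition G xss"
    "\<And>v. v \<in> verts G \<Longrightarrow> sum_list (map (trail_ends v) xss) = 1"
proof -
  obtain xss where xss: "trail_decomposition G xss"
    and min: "\<And>yss. trail_decomposition G yss \<Longrightarrow> length xss \<le> length yss"
    using trail_decomposition_exists[OF G] ex_has_least_nat[of "trail_decomposition G" _ length]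
    by blast
  have "sum_list (map (trail_ends v) xss) = 1" if v: "v \<in> verts G" for v
  proof (rule ccontr)
    assume ne: "sum_list (map (trail_ends v) xss) \<noteq> 1"
    \<comment> \<open>With constant labels 1 each passage contributes 2, so the degree and the
      number of trail ends at \<open>v\<close> have the same parity.\<close>
    obtain k where "dart_sum v (\<lambda>_. 1) (\<lambda>_. 1) (concat xss)
        = 2 * k + sum_list (map (trail_ends v) xss)"
      using concat_trails_sum[of xss "\<lambda>_. 1" "\<lambda>_. 1" 2 v] xss
      by (auto simp: trail_decomposition_def)
    then have "degree G v = 2 * k + sum_list (map (trail_ends v) xss)"
      using degree_dart_sum[OF G, of "concat xss" v] xss by (simp add: trail_decomposition_def)
    then have "odd (sum_list (map (trail_ends v) xss))" using bspec[OF odd v] by simp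
    then obtain t where "sum_list (map (trail_ends v) xss) = 2 * t + 1" by (elim oddE)
    with ne have ge: "sum_list (map (trail_ends v) xss) \<ge> 3" by (cases t) simp_all
    obtain P S Q T R where split: "xss = P @ S # Q @ T # R"
      and ends: "trail_ends v S \<noteq> 0" "trail_ends v T \<noteq> 0"
      using split_two_positive[OF trail_ends_le ge] by blast
    have trails: "\<forall>U\<in>set xss. U \<noteq> [] \<and> trail U"
      using xss by (simp add: trail_decomposition_def)
    then have "S \<noteq> []" "trail S" "T \<noteq> []" "trail T" by (simp_all add: split)
    then obtain U where U: "U \<noteq> []" "trail U"
      "mset (map dart_edge U) = mset (map dart_edge S) + mset (map dart_edge T)"
      using join_trails[of S v T] ends by blast
    \<comment> \<open>Replacing \<open>S\<close> and \<open>T\<close> by \<open>U\<close> saves one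
      trail, against minimality.\<close>
    have "mset (map dart_edge (concat (U # P @ Q @ R))) = mset (map dart_edge (concat xss))"
      using U(3) by (simp add: split)
    moreover have "\<forall>T\<in>set (U # P @ Q @ R). T \<noteq> [] \<and> trail T"
      using trails U(1,2) by (simp add: split)
    ultimately have "trail_decomposition G (U # P @ Q @ R)"
      using xss unfolding trail_decomposition_def edge_order_def by metis
    from min[OF this] show False by (simp add: split)
  qed
  with xss show thesis using that by blast
qed

subsection \<open>The labels\<close>

text \<open>Write the labels of the outer edges as \<open>2 * m + y\<close>. Along the concatenation \<open>y\<close> takes the
  values \<open>m, m - 1, -(m - 1), -(m - 2), m - 2, m - 3, \<dots>\<close>, so both outer edges at one position carry
  consecutive values of the same sign. The positive positions (the even ones) get the
  large middle labels and the negative positions the small ones, both increasing with \<open>y\<close>; the two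
  sums at a position are then consecutive and move in steps of 3 within each sign.\<close>

definition tail_label :: "nat \<Rightarrow> nat \<Rightarrow> nat" where
  "tail_label m i = (if even i then 3 * m - i else m + i)"

definition head_label :: "nat \<Rightarrow> nat \<Rightarrow> nat" where
  "head_label m i = (if even i then 3 * m - i - 1 else m + i + 1)"

definition middle_label :: "nat \<Rightarrow> nat \<Rightarrow> nat" where
  "middle_label m i = (if even i then m - i div 2 else (i + 1) div 2)"

text \<open>The head label is \<open>2 * m + y\<close> and the next tail label
  \<open>2 * m - y\<close>.\<close>

lemma tail_head_label: "Suc i < m \<Longrightarrow> tail_label m (Suc i) + head_label m i = 4 * m"
  by (auto simp: tail_label_def head_label_def)

text \<open>Eliminates division and truncated subtraction, so that linear arithmetic can settle
  bounds and equalities.\<close>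

lemma label_cases:
  assumes "i < m"
  obtains a where "i = 2 * a" "tail_label m i + 2 * a = 3 * m" "head_label m i + 2 * a + 1 = 3 * m"
    "middle_label m i + a = m"
  | a where "i = 2 * a + 1" "tail_label m i = m + 2 * a + 1" "head_label m i = m + 2 * a + 2"
    "middle_label m i = a + 1"
  using assms by (cases "even i") (auto simp: tail_label_def head_label_def middle_label_def
      elim!: evenE oddE)

lemma label_bounds:
  assumes "i < m"
  shows "m < tail_label m i" "tail_label m i \<le> 3 * m" "m < head_label m i" "head_label m i \<le> 3 * m"
    "0 < middle_label m i" "middle_label m i \<le> m"
  using assms by (cases rule: label_cases[OF assms]; linarith)+

text \<open>Within one parity of positions each quantity is strictly monotone, and its values at
  even positions exceed those at odd ones; for the two sums the threshold is
  \<open>5 * m / 2\<close>.\<close>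

lemma label_eqD:
  assumes i: "i < m" and j: "j < m"
  shows "tail_label m i = tail_label m j \<Longrightarrow> i = j" "head_label m i = head_label m j \<Longrightarrow> i = j"
    "middle_label m i = middle_label m j \<Longrightarrow> i = j"
    "tail_label m i + middle_label m i = tail_label m j + middle_label m j \<Longrightarrow> i = j"
    "head_label m i + middle_label m i = head_label m j + middle_label m j \<Longrightarrow> i = j"
  using assms by (cases rule: label_cases[OF i]; cases rule: label_cases[OF j]; linarith)+

text \<open>Positions of different parity are separated by size. For equal parity the two labels
  differ modulo 2 and the two sums differ modulo 3.\<close>

lemma tail_head_label_neq:
  assumes i: "i < m" and j: "j < m"
  shows "tail_label m i \<noteq> head_label m j"
    "tail_label m i + middle_label m i \<noteq> head_label m j + middle_label m j"
proof -
  have "\<not> (tail_label m i = head_label m j \<or>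
      tail_label m i + middle_label m i = head_label m j + middle_label m j)" (is "\<not> ?E")
  proof
    assume E: ?E
    consider a b where "i = 2 * a" "j = 2 * b" | a b where "i = 2 * a" "j = 2 * b + 1"
      | a b where "i = 2 * a + 1" "j = 2 * b" | a b where "i = 2 * a + 1" "j = 2 * b + 1"
      by (metis evenE oddE)
    then show False
    proof cases
      case 1
      then have "2 * a = 2 * b + 1 \<or> 3 * a = 3 * b + 1"
        using E i j by (auto simp: tail_label_def head_label_def middle_label_def)
      then show False by presburger
    next
      case 4
      then have "2 * a + 1 = 2 * b + 2 \<or> 3 * a + 2 = 3 * b + 3"
        using E i j by (auto simp: tail_label_def head_label_def middle_label_def)
      then show False by presburger
    qed (use E i j in \<open>auto simp: tail_label_def head_label_def middle_label_def\<close>)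
  qed
  then show "tail_label m i \<noteq> head_label m j"
    "tail_label m i + middle_label m i \<noteq> head_label m j + middle_label m j" by auto
qed

subsection \<open>The labeling of the subdivision\<close>

definition tail_edge :: "'a \<times> 'a \<Rightarrow> 'a subdiv_vertex set" where
  "tail_edge d = {Orig (fst d), Sub (fst d) (snd d)}"

definition head_edge :: "'a \<times> 'a \<Rightarrow> 'a subdiv_vertex set" where
  "head_edge d = {Orig (snd d), Sub (snd d) (fst d)}"

definition middle_edge :: "'a \<times> 'a \<Rightarrow> 'a subdiv_vertex set" where
  "middle_edge d = {Sub (fst d) (snd d), Sub (snd d) (fst d)}"

lemmas subdiv_edge_defs = tail_edge_def head_edge_def middle_edge_def

lemma dart_edge_eq_iff: "dart_edge d = {u, v} \<longleftrightarrow> d = (u, v) \<or> d = (v, u)"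
  by (cases d) (auto simp: dart_edge_def doubleton_eq_iff)

text \<open>Reversing a dart exchanges its outer edges, so a tail edge and a head edge coincide only
  for opposite darts.\<close>

lemma subdiv_edge_eq_iff:
  "tail_edge d = tail_edge e \<longleftrightarrow> d = e" "head_edge d = head_edge e \<longleftrightarrow> d = e"
  "tail_edge d = head_edge e \<longleftrightarrow> d = prod.swap e"
  "tail_edge d \<noteq> middle_edge e" "head_edge d \<noteq> middle_edge e"
  by (cases d; cases e; simp add: subdiv_edge_defs doubleton_eq_iff; blast)+

lemma middle_edge_eq_iff: "middle_edge d = middle_edge e \<longleftrightarrow> dart_edge d = dart_edge e"
  by (cases d; cases e) (auto simp: middle_edge_def dart_edge_def doubleton_eq_iff)

lemma doubleton_in_dart_edge_image: "{u, v} \<in> dart_edge ` D \<longleftrightarrow> (u, v) \<in> D \<or> (v, u) \<in> D"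
proof -
  have "{u, v} \<in> dart_edge ` D \<longleftrightarrow> (\<exists>d\<in>D. dart_edge d = {u, v})" by (metis image_iff)
  then show ?thesis unfolding dart_edge_eq_iff by blast
qed

lemma edges_subdivision2:
  assumes "dart_edge ` D = edges G"
  shows "edges (subdivision2 G) = tail_edge ` D \<union> head_edge ` D \<union> middle_edge ` D"
proof -
  have t: "tail_edge ` D = {{Orig u, Sub u v} | u v. (u, v) \<in> D}"
    by (force simp: tail_edge_def)
  have h: "head_edge ` D = {{Orig u, Sub u v} | u v. (v, u) \<in> D}"
    by (force simp: head_edge_def)
  have m: "middle_edge ` D = {{Sub u v, Sub v u} | u v. (u, v) \<in> D}"
    by (force simp: middle_edge_def)
  \<comment> \<open>A middle edge does not depend on the orientation of its dart.\<close>
  have m': "{{Sub u v, Sub v u} | u v. (u, v) \<in> D} = {{Sub u v, Sub v u} | u v. (v, u) \<in> D}"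
    by (auto simp: insert_commute)
  show ?thesis
    unfolding subdivision2_def ugraph.simps t h m assms[symmetric] doubleton_in_dart_edge_image
    using m' by blast
qed

lemma incident_edges_Sub:
  assumes "simple_graph G" "{u, v} \<in> edges G"
  shows "incident_edges (subdivision2 G) (Sub u v) = {{Orig u, Sub u v}, {Sub u v, Sub v u}}"
  using assms(2) by (auto simp: incident_edges_def subdivision2_def insert_commute[of v u])

lemma incident_edges_Orig:
  assumes "dart_edge ` D = edges G"
  shows "incident_edges (subdivision2 G) (Orig v) =
    tail_edge ` {d \<in> D. fst d = v} \<union> head_edge ` {d \<in> D. snd d = v}"
  unfolding incident_edges_def edges_subdivision2[OF assms]
  by (auto simp: subdiv_edge_defs)

text \<open>Lets the formulas for vertex sums in the subdivision compute its degrees too.\<close>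

lemma degree_eq_vertex_sum: "degree G v = vertex_sum G (\<lambda>_. 1) v"
  by (simp add: degree_def vertex_sum_def)

text \<open>If a tail edge and a head edge coincided, their darts would be opposite; as an edge
  occurs only once, they would be the same dart, hence a loop.\<close>

lemma edge_order_nth:
  assumes G: "simple_graph G" and ds: "edge_order G ds"
  shows "d \<in> set ds \<Longrightarrow> fst d \<noteq> snd d" "inj_on dart_edge (set ds)" "distinct ds"
    "d \<in> set ds \<Longrightarrow> e \<in> set ds \<Longrightarrow> tail_edge d \<noteq> head_edge e"
proof -
  note * = edge_orderD[OF assms]
  show inj: "inj_on dart_edge (set ds)" and "distinct ds" using *(1) by (auto simp: distinct_map)
  have neq: "fst d \<noteq> snd d" if "d \<in> set ds" for d
    using that *(2) simple_graph_edgeD[OF G, of "fst d" "snd d"] by (auto simp: dart_edge_def)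
  then show "d \<in> set ds \<Longrightarrow> fst d \<noteq> snd d" .
  show "tail_edge d \<noteq> head_edge e" if d: "d \<in> set ds" and e: "e \<in> set ds"
  proof
    assume "tail_edge d = head_edge e"
    then have swap: "d = prod.swap e" by (simp add: subdiv_edge_eq_iff)
    then have "dart_edge d = dart_edge e" by (auto simp: dart_edge_def)
    then have "d = e" using inj d e by (simp add: inj_on_eq_iff)
    then show False using swap neq[OF d] by (metis fst_swap)
  qed
qed

text \<open>The incident edges split disjointly into tail edges of darts leaving \<open>v\<close>
  and head edges of darts entering it; positions enumerate the darts without repetition.\<close>

lemma vertex_sum_Orig:
  assumes G: "simple_graph G" and ds: "edge_order G ds"
  shows "vertex_sum (subdivision2 G) f (Orig v) =
    dart_sum v (\<lambda>i. f (tail_edge (ds ! i))) (\<lambda>i. f (head_edge (ds ! i))) ds"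
proof -
  have inj: "inj_on tail_edge D" "inj_on head_edge D" for D :: "('a \<times> 'a) set"
    by (simp_all add: inj_on_def subdiv_edge_eq_iff)
  have "vertex_sum (subdivision2 G) f (Orig v) =
    (\<Sum>d\<in>{d \<in> set ds. fst d = v}. f (tail_edge d)) + (\<Sum>d\<in>{d \<in> set ds. snd d = v}. f (head_edge d))"
    unfolding vertex_sum_def incident_edges_Orig[OF edge_orderD(2)[OF assms]]
  proof (subst sum.union_disjoint)
    show "tail_edge ` {d \<in> set ds. fst d = v} \<inter> head_edge ` {d \<in> set ds. snd d = v} = {}"
      using edge_order_nth(4)[OF assms] by blast
    show "sum f (tail_edge ` {d \<in> set ds. fst d = v}) + sum f (head_edge ` {d \<in> set ds. snd d = v}) =
      (\<Sum>d\<in>{d \<in> set ds. fst d = v}. f (tail_edge d)) + (\<Sum>d\<in>{d \<in> set ds. snd d = v}. f (head_edge d))"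
      by (simp add: sum.reindex inj)
  qed auto
  also have "\<dots> = (\<Sum>d\<in>set ds. of_bool (fst d = v) * f (tail_edge d) +
      of_bool (snd d = v) * f (head_edge d))"
    by (simp add: sum.distrib sum.inter_filter of_bool_def if_distrib[of "\<lambda>x. x * _"] cong: if_cong)
  also have "\<dots> = dart_sum v (\<lambda>i. f (tail_edge (ds ! i))) (\<lambda>i. f (head_edge (ds ! i))) ds"
    unfolding dart_sum_def
    by (rule sum.reindex_bij_betw[symmetric], rule bij_betw_nth)
      (use edge_order_nth(3)[OF assms] in auto)
  finally show ?thesis .
qed

lemma degree_Orig:
  assumes "simple_graph G" "edge_order G ds"
  shows "degree (subdivision2 G) (Orig v) = degree G v"
  unfolding degree_dart_sum[OF assms] degree_eq_vertex_sum[of "subdivision2 G"]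
    vertex_sum_Orig[OF assms] ..

lemma vertex_sum_Sub:
  assumes G: "simple_graph G" and e: "{u, v} \<in> edges G"
  shows "vertex_sum (subdivision2 G) f (Sub u v) = f {Orig u, Sub u v} + f {Sub u v, Sub v u}"
  unfolding vertex_sum_def incident_edges_Sub[OF assms] by (simp add: doubleton_eq_iff)

text \<open>Values can be prescribed freely by position: the three kinds of edges are disjoint, and
  within each kind an edge determines its dart in \<open>ds\<close>.\<close>

lemma exists_labeling:
  assumes G: "simple_graph G" and ds: "edge_order G ds"
  obtains f where
    "\<And>i. i < length ds \<Longrightarrow> f (tail_edge (ds ! i)) = A i"
    "\<And>i. i < length ds \<Longrightarrow> f (head_edge (ds ! i)) = B i"
    "\<And>i. i < length ds \<Longrightarrow> f (middle_edge (ds ! i)) = Z i"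
proof -
  note inj = edge_order_nth(2)[OF assms] and dist = edge_order_nth(3)[OF assms]
  define pos where "pos g = inv_into {..<length ds} (\<lambda>i. g (ds ! i))"
    for g :: "'a \<times> 'a \<Rightarrow> 'a subdiv_vertex set"
  have pos: "pos g (g (ds ! i)) = i" if "inj_on g (set ds)" "i < length ds" for g i
  proof -
    have "inj_on ((!) ds) {..<length ds}" using dist by (simp add: inj_on_nth)
    moreover have "inj_on g ((!) ds ` {..<length ds})"
      using that(1) by (rule inj_on_subset) auto
    ultimately have "inj_on (g \<circ> (!) ds) {..<length ds}" by (rule comp_inj_on)
    then show ?thesis
      using that(2) unfolding pos_def by (intro inv_into_f_f) (simp_all add: o_def)
  qed
  have injs: "inj_on tail_edge (set ds)" "inj_on head_edge (set ds)" "inj_on middle_edge (set ds)"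
    using inj by (simp_all add: inj_on_def subdiv_edge_eq_iff middle_edge_eq_iff)
  \<comment> \<open>The last branch serves the middle edges; its value on sets that are not edges is
    immaterial.\<close>
  define f where "f s = (if s \<in> tail_edge ` set ds then A (pos tail_edge s)
    else if s \<in> head_edge ` set ds then B (pos head_edge s) else Z (pos middle_edge s))" for s
  show thesis
  proof (rule that[of f])
    fix i assume i: "i < length ds"
    then have mem: "ds ! i \<in> set ds" by simp
    have "head_edge (ds ! i) \<notin> tail_edge ` set ds"
      using edge_order_nth(4)[OF assms _ mem] by (metis imageE)
    moreover have "middle_edge (ds ! i) \<notin> tail_edge ` set ds"
      "middle_edge (ds ! i) \<notin> head_edge ` set ds"
      using subdiv_edge_eq_iff(4,5) by (metis imageE)+
    ultimately show "f (tail_edge (ds ! i)) = A i" "f (head_edge (ds ! i)) = B i"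
      "f (middle_edge (ds ! i)) = Z i"
      using mem i by (simp_all add: f_def pos injs)
  qed
qed

section \<open>Comparison of all vertex sums\<close>

theorem theorem4p1:
  fixes G :: "'a ugraph"
  assumes "simple_graph G"
    and "\<forall>v\<in>verts G. odd (degree G v) \<and> degree G v \<ge> 3"
  shows "strongly_antimagic (subdivision2 G)"
proof -
  obtain xss where xss: "trail_decomposition G xss"
    and ends: "\<And>v. v \<in> verts G \<Longrightarrow> sum_list (map (trail_ends v) xss) = 1"
    using odd_trail_decomposition[OF assms(1)] assms(2) by blast
  define ds where "ds = concat xss"
  define m where "m = length ds"
  have ds: "edge_order G ds" using xss by (simp add: ds_def trail_decomposition_def)
  note order = edge_orderD[OF assms(1) ds]
  obtain f where f: "\<And>i. i < m \<Longrightarrow> f (tail_edge (ds ! i)) = tail_label m i"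
    "\<And>i. i < m \<Longrightarrow> f (head_edge (ds ! i)) = head_label m i"
    "\<And>i. i < m \<Longrightarrow> f (middle_edge (ds ! i)) = middle_label m i"
    using exists_labeling[OF assms(1) ds] unfolding m_def by blast
  let ?S = "subdivision2 G"
  have ds_nth: "\<exists>i<m. d = ds ! i" if "d \<in> set ds" for d
    using that by (auto simp: in_set_conv_nth m_def)
  have edge_cases: "\<exists>i<m. e = tail_edge (ds ! i) \<and> f e = tail_label m i \<or>
      e = head_edge (ds ! i) \<and> f e = head_label m i \<or>
      e = middle_edge (ds ! i) \<and> f e = middle_label m i" if "e \<in> edges ?S" for e
    using that f unfolding edges_subdivision2[OF order(2)] by (blast dest: ds_nth)
  have "inj_on f (edges ?S)"
  proof (rule inj_onI)
    fix e e' assume e: "e \<in> edges ?S" and e': "e' \<in> edges ?S" and eq: "f e = f e'"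
    obtain i where i: "i < m" "e = tail_edge (ds ! i) \<and> f e = tail_label m i \<or>
      e = head_edge (ds ! i) \<and> f e = head_label m i \<or>
      e = middle_edge (ds ! i) \<and> f e = middle_label m i" using edge_cases[OF e] by blast
    obtain j where j: "j < m" "e' = tail_edge (ds ! j) \<and> f e' = tail_label m j \<or>
      e' = head_edge (ds ! j) \<and> f e' = head_label m j \<or>
      e' = middle_edge (ds ! j) \<and> f e' = middle_label m j" using edge_cases[OF e'] by blast
    \<comment> \<open>Two edges of the same kind are separated by injectivity, tail from head edges
      by \<open>tail_head_label_neq\<close>, and outer from middle edges by the bound
      \<open>m\<close>.\<close>
    show "e = e'"
      using i(2) j(2) eq label_bounds[OF i(1)] label_bounds[OF j(1)] label_eqD(1-3)[OF i(1) j(1)]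
        tail_head_label_neq(1)[OF i(1) j(1)] tail_head_label_neq(1)[OF j(1) i(1)]
      by (elim disjE conjE) auto
  qed
  moreover have "f ` edges ?S \<subseteq> {1..3 * m}"
  proof
    fix y assume "y \<in> f ` edges ?S"
    then obtain e where e: "e \<in> edges ?S" "y = f e" by blast
    from edge_cases[OF e(1)] obtain i where "i < m"
      "f e = tail_label m i \<or> f e = head_label m i \<or> f e = middle_label m i" by blast
    then show "y \<in> {1..3 * m}" using label_bounds[of i m] e(2) by auto
  qed
  moreover have card: "card (edges ?S) = 3 * m"
    using card_edges_subdivision2[OF assms(1)] order(3) by (simp add: m_def)
  ultimately have bij: "bij_betw f (edges ?S) {1..card (edges ?S)}"
    unfolding bij_betw_def by (simp add: card_image card_subset_eq)

  \<comment> \<open>\<open>x\<close> is the label at the single trail end at \<open>v\<close>, and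
    \<open>0 < k\<close> because the degree is at least 3.\<close>
  have orig: "\<exists>k x. vertex_sum ?S f (Orig v) = 4 * m * k + x \<and> degree ?S (Orig v) = 2 * k + 1 \<and>
      0 < k \<and> x \<in> dart_values v (tail_label m) (head_label m) ds" if v: "v \<in> verts G" for v
  proof -
    obtain k L where kL: "dart_sum v (tail_label m) (head_label m) ds = 4 * m * k + sum_list L"
      "dart_sum v (\<lambda>_. 1) (\<lambda>_. 1) ds = 2 * k + length L" "length L = 1"
      "set L \<subseteq> dart_values v (tail_label m) (head_label m) ds"
      using concat_trails_sum[of xss "tail_label m" "head_label m" "4 * m" v] xss ends[OF v]
        tail_head_label by (auto simp: trail_decomposition_def m_def ds_def)
    obtain x where L: "L = [x]" using kL(3) by (auto simp: length_Suc_conv)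
    have "vertex_sum ?S f (Orig v) = dart_sum v (tail_label m) (head_label m) ds"
      unfolding vertex_sum_Orig[OF assms(1) ds] dart_sum_def
      by (rule sum.cong) (auto simp: f simp flip: m_def)
    moreover have "degree G v = 2 * k + 1"
      using degree_dart_sum[OF assms(1) ds, of v] kL by simp
    moreover have "degree G v \<ge> 3" using assms(2) v by blast
    ultimately show ?thesis
      using kL L degree_Orig[OF assms(1) ds, of v]
      by (intro exI[of _ k] exI[of _ x]) auto
  qed
  have value_bounds: "m < x \<and> x \<le> 3 * m" if "x \<in> dart_values v (tail_label m) (head_label m) ds" for x v
    using that label_bounds[of _ m] by (auto simp: dart_values_def simp flip: m_def)
  \<comment> \<open>Outer labels are distinct, so a label determines its edge and the original
    vertex on it.\<close>
  have value_owner: "v = w" if xv: "x \<in> dart_values v (tail_label m) (head_label m) ds"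
    and xw: "x \<in> dart_values w (tail_label m) (head_label m) ds" for x v w
  proof -
    have D: "\<exists>i<m. x = tail_label m i \<and> fst (ds ! i) = u \<or> x = head_label m i \<and> snd (ds ! i) = u"
      if "x \<in> dart_values u (tail_label m) (head_label m) ds" for u
      using that by (auto simp: dart_values_def simp flip: m_def)
    obtain i where i: "i < m"
      "x = tail_label m i \<and> fst (ds ! i) = v \<or> x = head_label m i \<and> snd (ds ! i) = v"
      using D[OF xv] by blast
    obtain j where j: "j < m"
      "x = tail_label m j \<and> fst (ds ! j) = w \<or> x = head_label m j \<and> snd (ds ! j) = w"
      using D[OF xw] by blast
    show ?thesis
      using i(2) j(2) label_eqD(1,2)[OF i(1) j(1)]
        tail_head_label_neq(1)[OF i(1) j(1)] tail_head_label_neq(1)[OF j(1) i(1)]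
      by (elim disjE conjE) auto
  qed
  \<comment> \<open>Both \<open>x\<close> and \<open>y\<close> lie above \<open>m\<close> and at
    most at \<open>3 * m\<close>, so they cannot make up for a step of \<open>4 * m\<close>.\<close>
  have less: "4 * m * k + x < 4 * m * l + y"
    if "k < l" "x \<in> dart_values v (tail_label m) (head_label m) ds"
      "y \<in> dart_values w (tail_label m) (head_label m) ds" for k l x y v w
  proof -
    have "4 * m * k + 4 * m \<le> 4 * m * l"
      using \<open>k < l\<close> by (metis Suc_leI mult_Suc_right mult_le_mono2 add.commute)
    then show ?thesis using value_bounds[OF that(2)] value_bounds[OF that(3)] by linarith
  qed

  \<comment> \<open>The orientation of the edge in \<open>ds\<close> decides whether
    \<open>Sub u v\<close> lies on the tail or the head side.\<close>
  have sub: "\<exists>i<m. ds ! i = (u, v) \<and> vertex_sum ?S f (Sub u v) = tail_label m i + middle_label m i \<or>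
      ds ! i = (v, u) \<and> vertex_sum ?S f (Sub u v) = head_label m i + middle_label m i"
    if e: "{u, v} \<in> edges G" for u v
  proof -
    have "(u, v) \<in> set ds \<or> (v, u) \<in> set ds"
      using e doubleton_in_dart_edge_image[of u v "set ds"] order(2) by simp
    then obtain i where "i < m" "ds ! i = (u, v) \<or> ds ! i = (v, u)"
      using ds_nth by metis
    then show ?thesis
      using f[of i] vertex_sum_Sub[OF assms(1) e, of f]
      by (intro exI[of _ i]) (auto simp: subdiv_edge_defs insert_commute)
  qed
  have sub_le: "vertex_sum ?S f (Sub u v) \<le> 4 * m" if "{u, v} \<in> edges G" for u v
    using sub[OF that] label_bounds[of _ m] by fastforce
  have sub_less: "vertex_sum ?S f (Sub u v) < vertex_sum ?S f (Orig w)"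
    if e: "{u, v} \<in> edges G" and w: "w \<in> verts G" for u v w
  proof -
    obtain k x where k: "vertex_sum ?S f (Orig w) = 4 * m * k + x" "0 < k"
      and x: "x \<in> dart_values w (tail_label m) (head_label m) ds" using orig[OF w] by blast
    from \<open>0 < k\<close> have "4 * m \<le> 4 * m * k" by simp
    then show ?thesis using k(1) sub_le[OF e] value_bounds[OF x] by linarith
  qed
  \<comment> \<open>Equal sums force the same position and the same side.\<close>
  have sub_inj: "Sub u v = Sub u' v'"
    if e: "{u, v} \<in> edges G" "{u', v'} \<in> edges G"
      and eq: "vertex_sum ?S f (Sub u v) = vertex_sum ?S f (Sub u' v')" for u v u' v'
  proof -
    let ?P = "\<lambda>u v i. ds ! i = (u, v) \<and> vertex_sum ?S f (Sub u v) = tail_label m i + middle_label m i \<or>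
      ds ! i = (v, u) \<and> vertex_sum ?S f (Sub u v) = head_label m i + middle_label m i"
    obtain i where i: "i < m" "?P u v i" using sub[OF e(1)] by blast
    obtain j where j: "j < m" "?P u' v' j" using sub[OF e(2)] by blast
    show ?thesis
      using i(2) j(2) eq label_eqD(4,5)[OF i(1) j(1)]
        tail_head_label_neq(2)[OF i(1) j(1)] tail_head_label_neq(2)[OF j(1) i(1)]
      by (elim disjE conjE) auto
  qed
  have orig_inj: "v = w" if v: "v \<in> verts G" and w: "w \<in> verts G"
    and eq: "vertex_sum ?S f (Orig v) = vertex_sum ?S f (Orig w)" for v w
  proof -
    obtain k x where k: "vertex_sum ?S f (Orig v) = 4 * m * k + x"
      "x \<in> dart_values v (tail_label m) (head_label m) ds" using orig[OF v] by blast
    obtain l y where l: "vertex_sum ?S f (Orig w) = 4 * m * l + y"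
      "y \<in> dart_values w (tail_label m) (head_label m) ds" using orig[OF w] by blast
    have "k = l" using less[OF _ k(2) l(2), of k l] less[OF _ l(2) k(2), of l k] k(1) l(1) eq
      by (metis linorder_neqE_nat less_irrefl)
    then show ?thesis using value_owner k l eq by auto
  qed

  have vert_cases: "(\<exists>v\<in>verts G. x = Orig v) \<or> (\<exists>u v. {u, v} \<in> edges G \<and> x = Sub u v)"
    if "x \<in> verts ?S" for x
    using that by (auto simp: subdivision2_def)
  have "inj_on (vertex_sum ?S f) (verts ?S)"
  proof (rule inj_onI)
    fix x y assume x: "x \<in> verts ?S" and y: "y \<in> verts ?S"
      and eq: "vertex_sum ?S f x = vertex_sum ?S f y"
    consider v w where "x = Orig v" "y = Orig w" "v \<in> verts G" "w \<in> verts G"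
      | u v w where "x = Sub u v" "{u, v} \<in> edges G" "y = Orig w" "w \<in> verts G"
      | u v w where "y = Sub u v" "{u, v} \<in> edges G" "x = Orig w" "w \<in> verts G"
      | u v u' v' where "y = Sub u v" "{u, v} \<in> edges G" "x = Sub u' v'" "{u', v'} \<in> edges G"
      using vert_cases[OF x] vert_cases[OF y] by blast
    then show "x = y"
    proof cases
      case 1
      then show ?thesis using orig_inj[OF 1(3,4)] eq by simp
    next
      case 2
      then show ?thesis using sub_less[OF 2(2,4)] eq by simp
    next
      case 3
      then show ?thesis using sub_less[OF 3(2,4)] eq by simp
    next
      case 4
      then show ?thesis using sub_inj[OF 4(4,2)] eq by simp
    qed
  qed
  moreover have "vertex_sum ?S f x < vertex_sum ?S f y"
    if x: "x \<in> verts ?S" and y: "y \<in> verts ?S" and deg: "degree ?S x < degree ?S y" for x y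
  proof -
    have deg_sub: "degree ?S (Sub u v) = 2" if "{u, v} \<in> edges G" for u v
      using vertex_sum_Sub[OF assms(1) that, of "\<lambda>_. 1"] by (simp add: degree_eq_vertex_sum)
    consider v w where "x = Orig v" "y = Orig w" "v \<in> verts G" "w \<in> verts G"
      | u v w where "x = Sub u v" "{u, v} \<in> edges G" "y = Orig w" "w \<in> verts G"
      | u v where "y = Sub u v" "{u, v} \<in> edges G" "x \<in> Orig ` verts G"
      | u v u' v' where "y = Sub u v" "{u, v} \<in> edges G" "x = Sub u' v'" "{u', v'} \<in> edges G"
      using vert_cases[OF x] vert_cases[OF y] by blast
    then show ?thesis
    proof cases
      case 1
      obtain k a where k: "vertex_sum ?S f (Orig v) = 4 * m * k + a" "degree ?S (Orig v) = 2 * k + 1"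
        "a \<in> dart_values v (tail_label m) (head_label m) ds" using orig[OF 1(3)] by blast
      obtain l b where l: "vertex_sum ?S f (Orig w) = 4 * m * l + b" "degree ?S (Orig w) = 2 * l + 1"
        "b \<in> dart_values w (tail_label m) (head_label m) ds" using orig[OF 1(4)] by blast
      from deg 1 k(2) l(2) have "k < l" by simp
      with less[OF _ k(3) l(3)] show ?thesis using 1 k(1) l(1) by simp
    next
      case 2
      then show ?thesis using sub_less by simp
    next
      case 3
      \<comment> \<open>Original vertices have degree at least 3 and new ones degree 2, so
        \<open>deg\<close> fails.\<close>
      then show ?thesis using deg deg_sub orig by fastforce
    next
      case 4
      then show ?thesis using deg deg_sub by simp
    qed
  qed
  ultimately show ?thesis
    using bij unfolding strongly_antimagic_def strongly_antimagic_labeling_def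
      antimagic_labeling_def by blast
qed

end
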